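(* Let $X$ be a Hilbert space, let $A$ with domain $D(A)\subset X$ be the infinitesimal generator of a $C_0$-semigroup $(T(t))_{t\ge 0}$ on $X$, and let $f:X\to X$ be a locally Lipschitz continuous function with $f(0)=0$. Assume that: (i) $f$ is Fréchet differentiable at $0$ with Fréchet derivative equal to zero there; (ii) the semigroup $(T(t))_{t\ge 0}$ is exponentially stable; (iii) there exist $\omega\in\mathbb{R}$ and a bounded, boundedly invertible, self-adjoint operator $Q\in\mathcal{L}(X)$ such that for all $x\in D(A)$ $$\langle x, QAx\rangle+\langle Ax, Qx\rangle\le \omega\|x\|^2 .$$ Then the abstract differential equation $$\dot{x}(t)=Ax(t)+f(x(t)),\qquad x(0)=x_0,$$ is (locally) exponentially stable around zero.
   Context: $\mathcal{L}(X)$ denotes the bounded linear operators from $X$ to $X$. The semigroup $(T(t))_{t\ge0}$ is exponentially stable if there exist $M$ and $\omega_0>0$ such that $\|T(t)\|\le Me^{-\omega_0 t}$ for all $t\ge 0$. Solutions of $\dot x(t)=Ax(t)+f(x(t))$, $x(0)=x_0$, are understood in the mild sense, i.e. continuous functions $x$ with $x(t)=T(t)x_0+\int_0^t T(t-s)f(x(s))\,ds$. "(Locally) exponentially stable around zero" has its standard meaning: there exist $r>0$, $C>0$ and $\alpha>0$ such that for every $x_0\in X$ with $\|x_0\|<r$ the solution $x(t)$ with $x(0)=x_0$ exists for all $t\ge0$ and satisfies $\|x(t)\|\le Ce^{-\alpha t}\|x_0\|$ for all $t\ge 0$. *)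

theory Defs
  imports "HOL-Analysis.Analysis"
begin

section \<open>Hilbert spaces over the real or complex scalars\<close>

text \<open>
  The scalar field of a Hilbert space: a normed field with conjugation. By the Gelfand-Mazur
  theorem the axioms leave only the reals (with trivial conjugation) and the complex numbers.
  The order \<open>a \<le> b\<close> says that \<open>b - a\<close> is a nonnegative real number; on the complex
  numbers this is the order of \<^theory>\<open>HOL-Library.Complex_Order\<close>.
\<close>

class real_or_complex = real_normed_field + ord +
  fixes conjugate :: "'a \<Rightarrow> 'a"
  assumes conjugate_add: "conjugate (a + b) = conjugate a + conjugate b"
    and conjugate_mult: "conjugate (a * b) = conjugate a * conjugate b"
    and conjugate_conjugate: "conjugate (conjugate a) = a"
    and mult_conjugate: "a * conjugate a = (norm a)\<^sup>2 *\<^sub>R 1"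
    and le_iff_diff_nonneg_real: "a \<le> b \<longleftrightarrow> (\<exists>r\<ge>0. b - a = r *\<^sub>R 1)"

instantiation real :: real_or_complex
begin
definition conjugate_real :: "real \<Rightarrow> real" where "conjugate_real a = a"
instance
  by standard
    (auto simp: conjugate_real_def power2_eq_square intro: exI[of _ "b - a" for a b])
end

instantiation complex :: real_or_complex
begin
definition conjugate_complex :: "complex \<Rightarrow> complex" where "conjugate_complex = cnj"
instance
proof
  fix a b :: complex
  show "a * conjugate a = (norm a)\<^sup>2 *\<^sub>R 1"
    by (simp add: conjugate_complex_def complex_norm_square scaleR_conv_of_real del: of_real_power)
  show "a \<le> b \<longleftrightarrow> (\<exists>r\<ge>0. b - a = r *\<^sub>R 1)"
    by (auto simp: less_eq_complex_def complex_eq_iff intro: exI[of _ "Re b - Re a"])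
qed (simp_all add: conjugate_complex_def)
end

text \<open>
  Completeness and the norm topology come from the class \<^class>\<open>banach\<close>; the last axiom says
  that the norm is induced by the inner product, which is linear in its first argument.
\<close>

locale hilbert_space = vector_space smul
  for smul :: "'k::real_or_complex \<Rightarrow> 'x::banach \<Rightarrow> 'x" +
  fixes ip :: "'x \<Rightarrow> 'x \<Rightarrow> 'k"
  assumes smul_of_real: "smul (of_real r) x = r *\<^sub>R x"
    and ip_add_left: "ip (x + y) z = ip x z + ip y z"
    and ip_smul_left: "ip (smul a x) y = a * ip x y"
    and ip_conjugate: "ip y x = conjugate (ip x y)"
    and ip_self: "ip x x = of_real ((norm x)\<^sup>2)"

lemma real_hilbert_space:
  "hilbert_space scaleR (inner :: 'a::{real_inner, banach} \<Rightarrow> 'a \<Rightarrow> real)"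
  by unfold_locales
    (simp_all add: algebra_simps conjugate_real_def inner_commute power2_norm_eq_inner)

lemma complex_hilbert_space:
  "hilbert_space (*) (\<lambda>x y :: complex. x * cnj y)"
  by unfold_locales
    (simp_all add: algebra_simps conjugate_complex_def complex_norm_square scaleR_conv_of_real
      del: of_real_power)


section \<open>Strongly continuous semigroups\<close>

definition c0_semigroup ::
  "('k::real_or_complex \<Rightarrow> 'x::banach \<Rightarrow> 'x) \<Rightarrow> (real \<Rightarrow> 'x \<Rightarrow>\<^sub>L 'x) \<Rightarrow> bool"
where
  "c0_semigroup smul T \<longleftrightarrow>
     (\<forall>t\<ge>0. Vector_Spaces.linear smul smul (blinfun_apply (T t))) \<and>
     T 0 = id_blinfun \<and>
     (\<forall>s\<ge>0. \<forall>t\<ge>0. T (s + t) = T s o\<^sub>L T t) \<and>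
     (\<forall>x. ((\<lambda>t. T t x) \<longlongrightarrow> x) (at_right 0))"

text \<open>\<open>A\<close> is only constrained on its domain \<open>D\<close>; its values outside \<open>D\<close> are junk.\<close>

definition infinitesimal_generator ::
  "(real \<Rightarrow> 'x::banach \<Rightarrow>\<^sub>L 'x) \<Rightarrow> 'x set \<Rightarrow> ('x \<Rightarrow> 'x) \<Rightarrow> bool"
where
  "infinitesimal_generator T D A \<longleftrightarrow>
     D = {x. \<exists>y. ((\<lambda>h. (T h x - x) /\<^sub>R h) \<longlongrightarrow> y) (at_right 0)} \<and>
     (\<forall>x\<in>D. ((\<lambda>h. (T h x - x) /\<^sub>R h) \<longlongrightarrow> A x) (at_right 0))"

definition exponentially_stable_semigroup :: "(real \<Rightarrow> 'x::banach \<Rightarrow>\<^sub>L 'x) \<Rightarrow> bool" where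
  "exponentially_stable_semigroup T \<longleftrightarrow>
     (\<exists>M \<omega>\<^sub>0. \<omega>\<^sub>0 > 0 \<and> (\<forall>t\<ge>0. norm (T t) \<le> M * exp (- \<omega>\<^sub>0 * t)))"


section \<open>Operators and nonlinearities\<close>

definition boundedly_invertible :: "('x::banach \<Rightarrow>\<^sub>L 'x) \<Rightarrow> bool" where
  "boundedly_invertible Q \<longleftrightarrow>
     (\<exists>R :: 'x \<Rightarrow>\<^sub>L 'x. Q o\<^sub>L R = id_blinfun \<and> R o\<^sub>L Q = id_blinfun)"

definition self_adjoint_wrt :: "('x::banach \<Rightarrow> 'x \<Rightarrow> 'k) \<Rightarrow> ('x \<Rightarrow>\<^sub>L 'x) \<Rightarrow> bool" where
  "self_adjoint_wrt ip Q \<longleftrightarrow> (\<forall>x y. ip (Q x) y = ip x (Q y))"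

definition locally_lipschitz :: "('x::metric_space \<Rightarrow> 'x) \<Rightarrow> bool" where
  "locally_lipschitz f \<longleftrightarrow> (\<forall>x. \<exists>u>0. \<exists>L. L-lipschitz_on (cball x u) f)"


section \<open>Mild solutions and stability\<close>

definition mild_solution ::
  "(real \<Rightarrow> 'x::banach \<Rightarrow>\<^sub>L 'x) \<Rightarrow> ('x \<Rightarrow> 'x) \<Rightarrow> 'x \<Rightarrow> (real \<Rightarrow> 'x) \<Rightarrow> bool"
where
  "mild_solution T f x\<^sub>0 x \<longleftrightarrow>
     continuous_on {0..} x \<and>
     (\<forall>t\<ge>0. (\<lambda>s. T (t - s) (f (x s))) integrable_on {0..t} \<and>
            x t = T t x\<^sub>0 + integral {0..t} (\<lambda>s. T (t - s) (f (x s))))"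

text \<open>
  The second conjunct on \<open>x\<close> expresses that \<open>x\<close> is \<^emph>\<open>the\<close> solution starting in \<open>x\<^sub>0\<close>.
\<close>

definition locally_exponentially_stable ::
  "(real \<Rightarrow> 'x::banach \<Rightarrow>\<^sub>L 'x) \<Rightarrow> ('x \<Rightarrow> 'x) \<Rightarrow> bool"
where
  "locally_exponentially_stable T f \<longleftrightarrow>
     (\<exists>r>0. \<exists>C>0. \<exists>\<alpha>>0. \<forall>x\<^sub>0. norm x\<^sub>0 < r \<longrightarrow>
        (\<exists>x. mild_solution T f x\<^sub>0 x \<and>
             (\<forall>y. mild_solution T f x\<^sub>0 y \<longrightarrow> (\<forall>t\<ge>0. y t = x t)) \<and>
             (\<forall>t\<ge>0. norm (x t) \<le> C * exp (- \<alpha> * t) * norm x\<^sub>0)))"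

end

theory Submission
  imports Defs
begin

text \<open>
  Let \<open>norm (T t) \<le> M exp (\<omega> t)\<close> with \<open>\<omega> < 0\<close>, and put \<open>\<kappa> = \<omega> / 2\<close>. The Picard map
  \<open>x \<mapsto> (\<lambda>t. T t x\<^sub>0 + \<integral>\<^sub>0\<^sup>t T (t - s) (f (x s)) ds)\<close> sends the curves with
  \<open>norm (x t) \<le> R exp (\<kappa> t)\<close>, \<open>R = 2 M norm x\<^sub>0\<close>, into themselves: the convolution costs a
  factor \<open>M / (\<kappa> - \<omega>)\<close>, which \<open>f x = o(norm x)\<close> compensates near zero. For small \<open>x\<^sub>0\<close> these
  curves stay in a ball on which \<open>f\<close> is Lipschitz, so the Picard map is a contraction for the
  weighted norm \<open>sup exp (- k t) norm (x t)\<close> with large \<open>k\<close>, and its fixed point is a decaying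
  mild solution. The contraction estimate on a compact time interval also shows that mild
  solutions are unique.
\<close>

lemma locally_lipschitz_imp_local_lipschitz:
  assumes "locally_lipschitz f"
  shows "local_lipschitz I X (\<lambda>_. f)"
proof (rule local_lipschitzI)
  fix t x
  obtain u L where "u > 0" "L-lipschitz_on (cball x u) f"
    using assms unfolding locally_lipschitz_def by blast
  thus "\<exists>u>0. \<exists>L. \<forall>t\<in>cball t u \<inter> I. L-lipschitz_on (cball x u \<inter> X) f"
    by (meson inf_le1 lipschitz_on_subset)
qed

lemma locally_lipschitz_imp_lipschitz_on_compact:
  assumes "locally_lipschitz f" "compact K"
  obtains L where "L-lipschitz_on K f"
  using local_lipschitz_compact_implies_lipschitz[OF
      locally_lipschitz_imp_local_lipschitz[OF assms(1)] assms(2), of "{0 :: real}"]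
  by auto

lemma has_derivative_zero_imp_norm_le:
  fixes f :: "'a::real_normed_vector \<Rightarrow> 'b::real_normed_vector"
  assumes "(f has_derivative (\<lambda>_. 0)) (at 0)" "f 0 = 0" "\<epsilon> > 0"
  obtains d where "d > 0" "\<And>x. norm x < d \<Longrightarrow> norm (f x) \<le> \<epsilon> * norm x"
  using assms unfolding has_derivative_at_alt by auto

lemma integral_exp_mult:
  fixes a :: real
  assumes "a \<noteq> 0" "t \<ge> 0"
  shows "integral {0..t} (\<lambda>s. exp (a * s)) = (exp (a * t) - 1) / a"
proof -
  have "((\<lambda>s. exp (a * s)) has_integral (exp (a * t) / a - exp (a * 0) / a)) {0..t}"
    using assms
    by (intro fundamental_theorem_of_calculus)
      (auto intro!: derivative_eq_intros simp flip: has_real_derivative_iff_has_vector_derivative)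
  thus ?thesis
    by (simp add: integral_unique diff_divide_distrib)
qed

definition exp_bounded_curves :: "real \<Rightarrow> real \<Rightarrow> (real \<Rightarrow> 'a::real_normed_vector) set" where
  "exp_bounded_curves R \<kappa> =
     {x. continuous_on {0..} x \<and> (\<forall>t\<ge>0. norm (x t) \<le> R * exp (\<kappa> * t))}"

lemma norm_exp_bounded_curve_le:
  assumes "x \<in> exp_bounded_curves R \<kappa>" "\<kappa> \<le> 0" "R \<ge> 0" "t \<ge> 0"
  shows "norm (x t) \<le> R"
proof -
  have "norm (x t) \<le> R * exp (\<kappa> * t)"
    using assms by (simp add: exp_bounded_curves_def)
  also have "\<dots> \<le> R * 1"
    using assms by (intro mult_left_mono) (auto intro: mult_nonpos_nonneg)
  finally show ?thesis by simp
qed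

lemma exp_bounded_curves_cong:
  assumes "x \<in> exp_bounded_curves R \<kappa>" "\<And>t. t \<ge> 0 \<Longrightarrow> x t = y t"
  shows "y \<in> exp_bounded_curves R \<kappa>"
  using assms by (auto simp: exp_bounded_curves_def elim: continuous_on_eq)

text \<open>
  Bounded continuous functions live on the whole line; only the values at times \<open>t \<ge> 0\<close> matter.
\<close>

definition weighted_bcontfun :: "real \<Rightarrow> (real \<Rightarrow> 'a::real_normed_vector) \<Rightarrow> real \<Rightarrow>\<^sub>C 'a" where
  "weighted_bcontfun k x = Bcontfun (\<lambda>t. exp (- k * max 0 t) *\<^sub>R x (max 0 t))"

definition unweighted_curve :: "real \<Rightarrow> (real \<Rightarrow>\<^sub>C 'a::real_normed_vector) \<Rightarrow> real \<Rightarrow> 'a" where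
  "unweighted_curve k z t = exp (k * t) *\<^sub>R apply_bcontfun z t"

lemma apply_weighted_bcontfun:
  assumes x: "x \<in> exp_bounded_curves R \<kappa>" and "\<kappa> \<le> k" "R \<ge> 0"
  shows "apply_bcontfun (weighted_bcontfun k x) t = exp (- k * max 0 t) *\<^sub>R x (max 0 t)"
proof -
  have "(\<lambda>t. exp (- k * max 0 t) *\<^sub>R x (max 0 t)) \<in> bcontfun"
  proof (rule bcontfun_normI)
    have cont: "continuous_on {0..} x"
      using x by (simp add: exp_bounded_curves_def)
    show "continuous_on UNIV (\<lambda>t. exp (- k * max 0 t) *\<^sub>R x (max 0 t))"
      by (intro continuous_intros continuous_on_compose2[OF cont]) auto
  next
    fix t :: real
    define s where "s = max 0 t"
    have "s \<ge> 0" by (simp add: s_def)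
    hence "norm (x s) \<le> R * exp (\<kappa> * s)"
      using x by (simp add: exp_bounded_curves_def)
    also have "\<dots> \<le> R * exp (k * s)"
      using assms(2,3) \<open>s \<ge> 0\<close> by (simp add: mult_left_mono mult_right_mono)
    finally have "norm (exp (- k * s) *\<^sub>R x s) \<le> R"
      by (simp add: exp_minus field_simps)
    thus "norm (exp (- k * max 0 t) *\<^sub>R x (max 0 t)) \<le> R"
      by (simp only: s_def)
  qed
  thus ?thesis
    by (simp add: weighted_bcontfun_def Bcontfun_inverse)
qed

lemma unweighted_curve_weighted_bcontfun:
  assumes "x \<in> exp_bounded_curves R \<kappa>" "\<kappa> \<le> k" "R \<ge> 0" "t \<ge> 0"
  shows "unweighted_curve k (weighted_bcontfun k x) t = x t"
  using assms by (simp add: unweighted_curve_def apply_weighted_bcontfun exp_minus)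

lemma dist_weighted_bcontfun_le:
  assumes x: "x \<in> exp_bounded_curves R \<kappa>" and y: "y \<in> exp_bounded_curves R \<kappa>"
    and "\<kappa> \<le> k" "R \<ge> 0"
    and le: "\<And>t. t \<ge> 0 \<Longrightarrow> norm (x t - y t) \<le> B * exp (k * t)"
  shows "dist (weighted_bcontfun k x) (weighted_bcontfun k y) \<le> B"
proof (rule dist_bound)
  fix t :: real
  define s where "s = max 0 t"
  have "dist (weighted_bcontfun k x t) (weighted_bcontfun k y t) = exp (- k * s) * norm (x s - y s)"
    using assms by (simp add: apply_weighted_bcontfun dist_norm s_def flip: scaleR_diff_right)
  also have "\<dots> \<le> exp (- k * s) * (B * exp (k * s))"
    by (intro mult_left_mono le) (auto simp: s_def)
  also have "\<dots> = B"
    by (simp add: exp_minus)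
  finally show "dist (weighted_bcontfun k x t) (weighted_bcontfun k y t) \<le> B" .
qed

lemma norm_unweighted_curve_diff_le:
  "norm (unweighted_curve k z t - unweighted_curve k z' t) \<le> dist z z' * exp (k * t)"
  using dist_bounded[of z t z']
  by (simp add: unweighted_curve_def dist_norm flip: scaleR_diff_right)

lemma complete_exp_bounded_unweighted_curves:
  "complete {z :: real \<Rightarrow>\<^sub>C 'a::banach. unweighted_curve k z \<in> exp_bounded_curves R \<kappa>}"
proof -
  have "unweighted_curve k z \<in> exp_bounded_curves R \<kappa>
      \<longleftrightarrow> z \<in> PiC {0..} (\<lambda>t. cball 0 (R * exp ((\<kappa> - k) * t)))" for z :: "real \<Rightarrow>\<^sub>C 'a"
  proof -
    have "continuous_on {0..} (unweighted_curve k z)"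
      unfolding unweighted_curve_def by (intro continuous_intros) auto
    moreover have "norm (unweighted_curve k z t) \<le> R * exp (\<kappa> * t)
        \<longleftrightarrow> norm (apply_bcontfun z t) \<le> R * exp ((\<kappa> - k) * t)" for t
      by (simp add: unweighted_curve_def left_diff_distrib exp_diff field_simps)
    ultimately show ?thesis
      by (auto simp: mem_PiC_iff exp_bounded_curves_def Pi_def)
  qed
  thus ?thesis
    by (simp add: complete_eq_closed closed_PiC)
qed

lemma exp_weighted_contraction_fixed_point:
  fixes \<Phi> :: "(real \<Rightarrow> 'a::banach) \<Rightarrow> real \<Rightarrow> 'a"
  assumes "R \<ge> 0" "\<kappa> \<le> k" "0 \<le> c" "c < 1"
    and into: "\<Phi> \<in> exp_bounded_curves R \<kappa> \<rightarrow> exp_bounded_curves R \<kappa>"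
    and contraction: "\<And>x y B t. x \<in> exp_bounded_curves R \<kappa> \<Longrightarrow> y \<in> exp_bounded_curves R \<kappa> \<Longrightarrow>
      (\<And>s. s \<ge> 0 \<Longrightarrow> norm (x s - y s) \<le> B * exp (k * s)) \<Longrightarrow> t \<ge> 0 \<Longrightarrow>
      norm (\<Phi> x t - \<Phi> y t) \<le> c * B * exp (k * t)"
  obtains x where "x \<in> exp_bounded_curves R \<kappa>" "\<And>t. t \<ge> 0 \<Longrightarrow> \<Phi> x t = x t"
proof -
  define K where "K = {z :: real \<Rightarrow>\<^sub>C 'a. unweighted_curve k z \<in> exp_bounded_curves R \<kappa>}"
  define G where "G z = weighted_bcontfun k (\<Phi> (unweighted_curve k z))" for z
  have mem: "\<Phi> (unweighted_curve k z) \<in> exp_bounded_curves R \<kappa>" if "z \<in> K" for z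
    using that into by (auto simp: K_def)
  have unweighted_G: "unweighted_curve k (G z) t = \<Phi> (unweighted_curve k z) t"
    if "z \<in> K" "t \<ge> 0" for z t
    unfolding G_def
    using mem[OF that(1)] \<open>\<kappa> \<le> k\<close> \<open>R \<ge> 0\<close> that(2) by (rule unweighted_curve_weighted_bcontfun)
  have "\<exists>!z\<in>K. G z = z"
  proof (rule Banach_fix)
    show "complete K"
      unfolding K_def by (rule complete_exp_bounded_unweighted_curves)
    have "0 \<in> K"
      using \<open>R \<ge> 0\<close> by (simp add: K_def exp_bounded_curves_def unweighted_curve_def)
    thus "K \<noteq> {}" by blast
    show "G ` K \<subseteq> K"
      using exp_bounded_curves_cong[OF mem unweighted_G[symmetric]] by (auto simp: K_def)
    show "dist (G z) (G z') \<le> c * dist z z'" if "z \<in> K" "z' \<in> K" for z z'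
      unfolding G_def
    proof (rule dist_weighted_bcontfun_le[OF mem[OF that(1)] mem[OF that(2)] \<open>\<kappa> \<le> k\<close> \<open>R \<ge> 0\<close>])
      fix t :: real assume "t \<ge> 0"
      thus "norm (\<Phi> (unweighted_curve k z) t - \<Phi> (unweighted_curve k z') t)
          \<le> c * dist z z' * exp (k * t)"
        using that by (intro contraction norm_unweighted_curve_diff_le) (auto simp: K_def)
    qed
  qed fact+
  then obtain z where "z \<in> K" "G z = z" by blast
  thus thesis
    using that[of "unweighted_curve k z"] unweighted_G[of z] by (simp add: K_def)
qed

locale exponentially_bounded_semigroup =
  fixes T :: "real \<Rightarrow> 'x::banach \<Rightarrow>\<^sub>L 'x" and M \<omega> :: real
  assumes T_zero: "T 0 = id_blinfun"
    and T_add: "s \<ge> 0 \<Longrightarrow> t \<ge> 0 \<Longrightarrow> T (s + t) = T s o\<^sub>L T t"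
    and T_tendsto: "((\<lambda>t. T t x) \<longlongrightarrow> x) (at_right 0)"
    and norm_T_le: "t \<ge> 0 \<Longrightarrow> norm (T t) \<le> M * exp (\<omega> * t)"
    and M_pos: "M > 0"
begin

lemma norm_T_apply_le: "t \<ge> 0 \<Longrightarrow> norm (T t x) \<le> M * exp (\<omega> * t) * norm x"
  using norm_blinfun[of "T t" x] mult_right_mono[OF norm_T_le, of t "norm x"] by simp

lemma norm_T_apply_diff_time_le:
  assumes "s \<ge> 0" "t \<ge> 0"
  shows "norm (T s x - T t x) \<le> M * exp (\<omega> * min s t) * norm (T \<bar>s - t\<bar> x - x)"
  using assms
proof (induction s t rule: linorder_wlog)
  case (le s t)
  have "T t x = T s (T \<bar>s - t\<bar> x)"
    using T_add[of s "t - s"] le by simp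
  hence "T s x - T t x = T s (x - T \<bar>s - t\<bar> x)"
    by (simp add: blinfun.diff_right)
  thus ?case
    using norm_T_apply_le[of s "x - T \<bar>s - t\<bar> x"] le by (simp add: norm_minus_commute)
next
  case (sym s t)
  thus ?case by (simp add: norm_minus_commute abs_minus_commute min.commute)
qed

lemma norm_T_apply_diff_le:
  assumes "s \<ge> 0" "t \<ge> 0"
  shows "norm (T s x - T t y)
    \<le> M * exp (\<omega> * s) * norm (x - y) + M * exp (\<omega> * min s t) * norm (T \<bar>s - t\<bar> y - y)"
proof -
  have "T s x - T t y = T s (x - y) + (T s y - T t y)"
    by (simp add: blinfun.diff_right)
  thus ?thesis
    using assms by (simp only: norm_triangle_mono norm_T_apply_le norm_T_apply_diff_time_le)
qed

lemma tendsto_T_abs_diff: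
  assumes "(p \<longlongrightarrow> a) F"
  shows "((\<lambda>z. T \<bar>p z - a\<bar> x) \<longlongrightarrow> x) F"
proof -
  have "continuous (at 0 within {0..}) (\<lambda>t. T t x)"
    using T_tendsto[of x] by (simp add: continuous_within T_zero at_within_Ici_at_right)
  moreover have "((\<lambda>z. \<bar>p z - a\<bar>) \<longlongrightarrow> 0) F"
    using assms by (intro tendsto_rabs_zero LIM_zero)
  ultimately have "((\<lambda>z. T \<bar>p z - a\<bar> x) \<longlongrightarrow> T 0 x) F"
    by (intro continuous_within_tendsto_compose'[where f = "\<lambda>t. T t x"]) auto
  thus ?thesis
    by (simp add: T_zero)
qed

lemma continuous_on_T_apply:
  assumes "continuous_on S p" "continuous_on S q" "\<And>z. z \<in> S \<Longrightarrow> p z \<ge> 0"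
  shows "continuous_on S (\<lambda>z. T (p z) (q z))"
  unfolding continuous_on_def
proof
  fix z assume z: "z \<in> S"
  define majorant where "majorant y = M * exp (\<omega> * p y) * norm (q y - q z)
    + M * exp (\<omega> * min (p y) (p z)) * norm (T \<bar>p y - p z\<bar> (q z) - q z)" for y
  have p: "(p \<longlongrightarrow> p z) (at z within S)" and q: "(q \<longlongrightarrow> q z) (at z within S)"
    using assms(1,2) z by (auto simp: continuous_on_def)
  have "norm (T (p y) (q y) - T (p z) (q z)) \<le> majorant y" if "y \<in> S" for y
    unfolding majorant_def using assms(3) that z by (intro norm_T_apply_diff_le)
  hence bound: "\<forall>\<^sub>F y in at z within S. norm (T (p y) (q y) - T (p z) (q z)) \<le> majorant y"
    by (simp add: eventually_at_filter)
  have "(majorant \<longlongrightarrow> M * exp (\<omega> * p z) * norm (q z - q z)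
      + M * exp (\<omega> * min (p z) (p z)) * norm (q z - q z)) (at z within S)"
    unfolding majorant_def by (intro tendsto_intros p q tendsto_T_abs_diff)
  hence "(majorant \<longlongrightarrow> 0) (at z within S)"
    by simp
  with bound have "((\<lambda>y. T (p y) (q y) - T (p z) (q z)) \<longlongrightarrow> 0) (at z within S)"
    by (rule Lim_null_comparison)
  thus "((\<lambda>y. T (p y) (q y)) \<longlongrightarrow> T (p z) (q z)) (at z within S)"
    by (simp add: LIM_zero_iff)
qed

definition convolution :: "(real \<Rightarrow> 'x) \<Rightarrow> real \<Rightarrow> 'x" where
  "convolution w t = integral {0..t} (\<lambda>s. T (t - s) (w s))"

lemma convolution_integrable:
  assumes "continuous_on {0..t} w"
  shows "(\<lambda>s. T (t - s) (w s)) integrable_on {0..t}"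
  by (intro integrable_continuous_interval continuous_on_T_apply continuous_intros assms) auto

lemma convolution_diff:
  assumes "continuous_on {0..t} v" "continuous_on {0..t} w"
  shows "convolution v t - convolution w t = convolution (\<lambda>s. v s - w s) t"
  unfolding convolution_def blinfun.diff_right
  by (intro Henstock_Kurzweil_Integration.integral_diff[symmetric] convolution_integrable assms)

lemma convolution_rescale:
  assumes "continuous_on {0..t} w" "t \<ge> 0"
  shows "convolution w t = t *\<^sub>R integral {0..1} (\<lambda>r. T (t - t * r) (w (t * r)))"
proof (cases "t = 0")
  case False
  from has_integral_stretch_real[OF
      integrable_integral[OF convolution_integrable[OF assms(1)]] False]
  have "((\<lambda>r. T (t - t * r) (w (t * r))) has_integral (1 / t) *\<^sub>R convolution w t) {0..1}"
    using False \<open>t \<ge> 0\<close> by (simp add: convolution_def)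
  thus ?thesis
    using False by (simp add: integral_unique)
qed (simp add: convolution_def)

lemma continuous_on_convolution:
  assumes "continuous_on {0..} w"
  shows "continuous_on {0..} (convolution w)"
proof -
  \<comment> \<open>After rescaling to \<open>{0..1}\<close>, only the integrand depends on \<open>t\<close>.\<close>
  have "continuous_on ({0..} \<times> cbox 0 1) (\<lambda>(t, r). T (t - t * r) (w (t * r)))"
    unfolding case_prod_unfold
    by (intro continuous_on_T_apply continuous_intros continuous_on_compose2[OF assms])
      (auto simp: mult_left_le)
  from integral_continuous_on_param[OF this]
  have "continuous_on {0..} (\<lambda>t. t *\<^sub>R integral {0..1} (\<lambda>r. T (t - t * r) (w (t * r))))"
    by (intro continuous_intros) simp
  thus ?thesis
    by (rule continuous_on_eq)
      (auto intro!: convolution_rescale[symmetric] continuous_on_subset[OF assms])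
qed

lemma norm_convolution_le:
  assumes w: "continuous_on {0..t} w" and le: "\<And>s. s \<in> {0..t} \<Longrightarrow> norm (w s) \<le> c * exp (\<kappa> * s)"
    and "t \<ge> 0" "\<omega> < \<kappa>"
  shows "norm (convolution w t) \<le> M * c / (\<kappa> - \<omega>) * exp (\<kappa> * t)"
proof -
  have "c \<ge> 0"
    using le[of 0] \<open>t \<ge> 0\<close> order_trans[OF norm_ge_zero] by fastforce
  have "norm (convolution w t) \<le> integral {0..t} (\<lambda>s. M * c * exp (\<omega> * t) * exp ((\<kappa> - \<omega>) * s))"
    unfolding convolution_def
  proof (rule integral_norm_bound_integral)
    fix s assume s: "s \<in> {0..t}"
    have "norm (T (t - s) (w s)) \<le> M * exp (\<omega> * (t - s)) * norm (w s)"
      using s by (intro norm_T_apply_le) auto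
    also have "\<dots> \<le> M * exp (\<omega> * (t - s)) * (c * exp (\<kappa> * s))"
      using le[OF s] M_pos by (intro mult_left_mono) auto
    also have "\<dots> = M * c * exp (\<omega> * t) * exp ((\<kappa> - \<omega>) * s)"
      by (simp add: algebra_simps flip: exp_add)
    finally show "norm (T (t - s) (w s)) \<le> M * c * exp (\<omega> * t) * exp ((\<kappa> - \<omega>) * s)" .
  qed (intro convolution_integrable w integrable_continuous_interval continuous_intros)+
  also have "\<dots> = M * c / (\<kappa> - \<omega>) * (exp (\<omega> * t) * (exp ((\<kappa> - \<omega>) * t) - 1))"
    using assms(3,4) by (simp add: integral_exp_mult)
  also have "exp (\<omega> * t) * (exp ((\<kappa> - \<omega>) * t) - 1) = exp (\<kappa> * t) - exp (\<omega> * t)"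
    by (simp add: algebra_simps flip: exp_add)
  also have "M * c / (\<kappa> - \<omega>) * (exp (\<kappa> * t) - exp (\<omega> * t)) \<le> M * c / (\<kappa> - \<omega>) * exp (\<kappa> * t)"
    using M_pos \<open>c \<ge> 0\<close> \<open>\<omega> < \<kappa>\<close> by (intro mult_left_mono) auto
  finally show ?thesis .
qed

definition picard :: "('x \<Rightarrow> 'x) \<Rightarrow> 'x \<Rightarrow> (real \<Rightarrow> 'x) \<Rightarrow> real \<Rightarrow> 'x" where
  "picard f x\<^sub>0 x t = T t x\<^sub>0 + convolution (\<lambda>s. f (x s)) t"

lemma picard_mild_solution_eq:
  "mild_solution T f x\<^sub>0 x \<Longrightarrow> t \<ge> 0 \<Longrightarrow> picard f x\<^sub>0 x t = x t"
  by (simp add: mild_solution_def picard_def convolution_def)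

lemma mild_solution_if_picard_fixed_point:
  assumes "continuous_on {0..} x" "continuous_on {0..} (\<lambda>s. f (x s))"
    and "\<And>t. t \<ge> 0 \<Longrightarrow> picard f x\<^sub>0 x t = x t"
  shows "mild_solution T f x\<^sub>0 x"
proof -
  have "(\<lambda>s. T (t - s) (f (x s))) integrable_on {0..t}" for t
    using assms(2) by (intro convolution_integrable) (auto elim: continuous_on_subset)
  thus ?thesis
    using assms(1,3) by (simp add: mild_solution_def picard_def convolution_def)
qed

lemma continuous_on_picard:
  assumes "continuous_on {0..} (\<lambda>s. f (x s))"
  shows "continuous_on {0..} (picard f x\<^sub>0 x)"
  unfolding picard_def
  by (intro continuous_intros continuous_on_T_apply continuous_on_convolution assms) auto

lemma norm_picard_diff_le:
  assumes f: "L-lipschitz_on Y f"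
    and x: "continuous_on {0..t} x" "x \<in> {0..t} \<rightarrow> Y"
    and y: "continuous_on {0..t} y" "y \<in> {0..t} \<rightarrow> Y"
    and le: "\<And>s. s \<in> {0..t} \<Longrightarrow> norm (x s - y s) \<le> B * exp (k * s)"
    and "t \<ge> 0" "\<omega> < k"
  shows "norm (picard f x\<^sub>0 x t - picard f x\<^sub>0 y t) \<le> M * L / (k - \<omega>) * B * exp (k * t)"
proof -
  have cont: "continuous_on {0..t} (\<lambda>s. f (x s))" "continuous_on {0..t} (\<lambda>s. f (y s))"
    using x y by (auto intro!: continuous_on_compose2[OF lipschitz_on_continuous_on[OF f]])
  have "norm (f (x s) - f (y s)) \<le> L * B * exp (k * s)" if s: "s \<in> {0..t}" for s
  proof -
    have "norm (f (x s) - f (y s)) \<le> L * norm (x s - y s)"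
      using s x y by (intro lipschitz_on_normD[OF f]) auto
    also have "\<dots> \<le> L * (B * exp (k * s))"
      using le[OF s] lipschitz_on_nonneg[OF f] by (rule mult_left_mono)
    finally show ?thesis by simp
  qed
  hence "norm (convolution (\<lambda>s. f (x s) - f (y s)) t) \<le> M * (L * B) / (k - \<omega>) * exp (k * t)"
    using assms(7,8) by (intro norm_convolution_le continuous_intros cont)
  thus ?thesis
    by (simp add: picard_def convolution_diff[OF cont])
qed

lemma picard_fixed_point_unique:
  assumes f: "L-lipschitz_on Y f"
    and x: "continuous_on {0..b} x" "x \<in> {0..b} \<rightarrow> Y" "\<And>t. t \<in> {0..b} \<Longrightarrow> picard f x\<^sub>0 x t = x t"
    and y: "continuous_on {0..b} y" "y \<in> {0..b} \<rightarrow> Y" "\<And>t. t \<in> {0..b} \<Longrightarrow> picard f x\<^sub>0 y t = y t"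
    and t: "t \<in> {0..b}"
  shows "x t = y t"
proof -
  define k where "k = \<omega> + 2 * M * L + 1"
  have "M * L \<ge> 0"
    using M_pos lipschitz_on_nonneg[OF f] by simp
  hence k: "\<omega> < k" "M * L / (k - \<omega>) \<le> 1 / 2"
    by (simp_all add: k_def field_simps)
  define \<delta> where "\<delta> s = exp (- k * s) * norm (x s - y s)" for s
  have norm_diff: "norm (x s - y s) = \<delta> s * exp (k * s)" for s
    by (simp add: \<delta>_def exp_minus)
  have "continuous_on {0..b} \<delta>"
    unfolding \<delta>_def by (intro continuous_intros x y)
  then obtain m where m: "m \<in> {0..b}" "\<And>s. s \<in> {0..b} \<Longrightarrow> \<delta> s \<le> \<delta> m"
    using continuous_attains_sup[of "{0..b}" \<delta>] t by auto
  have "norm (picard f x\<^sub>0 x m - picard f x\<^sub>0 y m) \<le> M * L / (k - \<omega>) * \<delta> m * exp (k * m)"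
  proof (rule norm_picard_diff_le[OF f])
    show "continuous_on {0..m} x" "continuous_on {0..m} y"
      using m(1) by (auto intro: continuous_on_subset[OF x(1)] continuous_on_subset[OF y(1)])
  qed (use m x(2) y(2) k(1) in \<open>auto simp: norm_diff\<close>)
  hence "\<delta> m * exp (k * m) \<le> M * L / (k - \<omega>) * \<delta> m * exp (k * m)"
    using m(1) by (simp add: x(3) y(3) flip: norm_diff)
  hence "\<delta> m \<le> M * L / (k - \<omega>) * \<delta> m"
    by (rule mult_right_le_imp_le) simp
  also have "\<dots> \<le> 1 / 2 * \<delta> m"
    using k(2) by (rule mult_right_mono) (simp add: \<delta>_def)
  finally have "\<delta> t \<le> 0"
    using m(2)[OF t] by simp
  thus ?thesis
    by (simp add: \<delta>_def mult_le_0_iff)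
qed

theorem mild_solution_unique:
  assumes f: "locally_lipschitz f" and x: "mild_solution T f x\<^sub>0 x" and y: "mild_solution T f x\<^sub>0 y"
    and "t \<ge> 0"
  shows "x t = y t"
proof -
  have cont: "continuous_on {0..t} x" "continuous_on {0..t} y"
    using x y by (auto simp: mild_solution_def elim: continuous_on_subset)
  hence "compact (x ` {0..t} \<union> y ` {0..t})"
    by (intro compact_Un compact_continuous_image) auto
  then obtain L where L: "L-lipschitz_on (x ` {0..t} \<union> y ` {0..t}) f"
    using f locally_lipschitz_imp_lipschitz_on_compact by blast
  show ?thesis
  proof (rule picard_fixed_point_unique[OF L cont(1) _ _ cont(2)])
    show "picard f x\<^sub>0 x s = x s" "picard f x\<^sub>0 y s = y s" if "s \<in> {0..t}" for s
      using that by (auto intro: picard_mild_solution_eq x y)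
  qed (use \<open>t \<ge> 0\<close> in auto)
qed

lemma norm_picard_le:
  assumes cont: "continuous_on {0..t} (\<lambda>s. f (x s))"
    and f: "\<And>s. s \<in> {0..t} \<Longrightarrow> norm (f (x s)) \<le> \<epsilon> * norm (x s)" and "\<epsilon> \<ge> 0"
    and x: "\<And>s. s \<in> {0..t} \<Longrightarrow> norm (x s) \<le> R * exp (\<kappa> * s)"
    and "t \<ge> 0" "\<omega> < \<kappa>"
  shows "norm (picard f x\<^sub>0 x t) \<le> (M * norm x\<^sub>0 + M * \<epsilon> / (\<kappa> - \<omega>) * R) * exp (\<kappa> * t)"
proof -
  have "norm (f (x s)) \<le> \<epsilon> * R * exp (\<kappa> * s)" if "s \<in> {0..t}" for s
    using order_trans[OF f[OF that] mult_left_mono[OF x[OF that] \<open>\<epsilon> \<ge> 0\<close>]] by (simp add: mult.assoc)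
  hence "norm (convolution (\<lambda>s. f (x s)) t) \<le> M * (\<epsilon> * R) / (\<kappa> - \<omega>) * exp (\<kappa> * t)"
    using cont assms(5,6) by (intro norm_convolution_le) auto
  moreover have "norm (T t x\<^sub>0) \<le> M * norm x\<^sub>0 * exp (\<kappa> * t)"
  proof -
    have "norm (T t x\<^sub>0) \<le> M * norm x\<^sub>0 * exp (\<omega> * t)"
      using norm_T_apply_le[OF \<open>t \<ge> 0\<close>, of x\<^sub>0] by (simp add: mult_ac)
    also have "\<dots> \<le> M * norm x\<^sub>0 * exp (\<kappa> * t)"
      using assms(5,6) M_pos by (intro mult_left_mono) (auto intro: mult_right_mono)
    finally show ?thesis .
  qed
  ultimately have "norm (picard f x\<^sub>0 x t)
      \<le> M * norm x\<^sub>0 * exp (\<kappa> * t) + M * (\<epsilon> * R) / (\<kappa> - \<omega>) * exp (\<kappa> * t)"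
    unfolding picard_def by (rule norm_triangle_mono[rotated])
  thus ?thesis
    by (simp add: distrib_right)
qed

lemma picard_maps_exp_bounded_curves:
  assumes f: "continuous_on (cball 0 R) f" "\<And>z. norm z \<le> R \<Longrightarrow> norm (f z) \<le> \<epsilon> * norm z"
    and "\<epsilon> \<ge> 0" "R \<ge> 0" "\<omega> < \<kappa>" "\<kappa> \<le> 0"
    and le: "M * norm x\<^sub>0 + M * \<epsilon> / (\<kappa> - \<omega>) * R \<le> R"
  shows "picard f x\<^sub>0 \<in> exp_bounded_curves R \<kappa> \<rightarrow> exp_bounded_curves R \<kappa>"
proof
  fix x :: "real \<Rightarrow> 'x" assume x: "x \<in> exp_bounded_curves R \<kappa>"
  have ball: "norm (x t) \<le> R" if "t \<ge> 0" for t
    using norm_exp_bounded_curve_le[OF x \<open>\<kappa> \<le> 0\<close> \<open>R \<ge> 0\<close> that] .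
  have cont: "continuous_on {0..} (\<lambda>s. f (x s))"
    using x ball by (intro continuous_on_compose2[OF f(1)]) (auto simp: exp_bounded_curves_def)
  have "norm (picard f x\<^sub>0 x t) \<le> R * exp (\<kappa> * t)" if t: "t \<ge> 0" for t
  proof -
    have "norm (picard f x\<^sub>0 x t) \<le> (M * norm x\<^sub>0 + M * \<epsilon> / (\<kappa> - \<omega>) * R) * exp (\<kappa> * t)"
    proof (rule norm_picard_le)
      show "continuous_on {0..t} (\<lambda>s. f (x s))"
        using cont by (rule continuous_on_subset) auto
    qed (use x ball f(2) assms(3,5) t in \<open>auto simp: exp_bounded_curves_def\<close>)
    also have "\<dots> \<le> R * exp (\<kappa> * t)"
      using le by (rule mult_right_mono) simp
    finally show ?thesis .
  qed
  thus "picard f x\<^sub>0 x \<in> exp_bounded_curves R \<kappa>"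
    using continuous_on_picard[where f = f, OF cont] by (simp add: exp_bounded_curves_def)
qed

lemma picard_fixed_point_exists:
  assumes f: "L-lipschitz_on (cball 0 R) f" and "R \<ge> 0" "\<omega> < \<kappa>" "\<kappa> \<le> 0"
    and into: "picard f x\<^sub>0 \<in> exp_bounded_curves R \<kappa> \<rightarrow> exp_bounded_curves R \<kappa>"
  obtains x where "x \<in> exp_bounded_curves R \<kappa>" "\<And>t. t \<ge> 0 \<Longrightarrow> picard f x\<^sub>0 x t = x t"
proof -
  define k where "k = \<kappa> + 2 * M * L"
  have nonneg: "M * L \<ge> 0"
    using M_pos lipschitz_on_nonneg[OF f] by simp
  hence k: "\<kappa> \<le> k" "\<omega> < k" "M * L / (k - \<omega>) \<le> 1 / 2"
    using \<open>\<omega> < \<kappa>\<close> by (simp_all add: k_def field_simps)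
  have contraction: "norm (picard f x\<^sub>0 x t - picard f x\<^sub>0 y t) \<le> M * L / (k - \<omega>) * B * exp (k * t)"
    if x: "x \<in> exp_bounded_curves R \<kappa>" and y: "y \<in> exp_bounded_curves R \<kappa>"
      and "\<And>s. s \<ge> 0 \<Longrightarrow> norm (x s - y s) \<le> B * exp (k * s)" "t \<ge> 0" for x y B t
  proof (rule norm_picard_diff_le[OF f])
    show "continuous_on {0..t} x" "continuous_on {0..t} y"
      using x y by (auto simp: exp_bounded_curves_def elim: continuous_on_subset)
    show "x \<in> {0..t} \<rightarrow> cball 0 R" "y \<in> {0..t} \<rightarrow> cball 0 R"
      using norm_exp_bounded_curve_le[OF x \<open>\<kappa> \<le> 0\<close> \<open>R \<ge> 0\<close>]
        norm_exp_bounded_curve_le[OF y \<open>\<kappa> \<le> 0\<close> \<open>R \<ge> 0\<close>] by auto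
  qed (use that k(2) in auto)
  have "0 \<le> M * L / (k - \<omega>)" "M * L / (k - \<omega>) < 1"
    using k nonneg by auto
  from exp_weighted_contraction_fixed_point[OF \<open>R \<ge> 0\<close> k(1) this into contraction]
  show thesis
    using that by blast
qed

theorem exp_decaying_mild_solution_exists:
  assumes f: "L-lipschitz_on (cball 0 d) f" "\<And>z. norm z \<le> d \<Longrightarrow> norm (f z) \<le> \<epsilon> * norm z"
    and "\<epsilon> \<ge> 0" "\<omega> < \<kappa>" "\<kappa> \<le> 0"
    and gap: "2 * M * \<epsilon> \<le> \<kappa> - \<omega>" and x\<^sub>0: "2 * M * norm x\<^sub>0 \<le> d"
  obtains x where "mild_solution T f x\<^sub>0 x"
    "\<And>t. t \<ge> 0 \<Longrightarrow> norm (x t) \<le> 2 * M * norm x\<^sub>0 * exp (\<kappa> * t)"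
proof -
  define R where "R = 2 * M * norm x\<^sub>0"
  have R: "R \<ge> 0" "R \<le> d"
    using x\<^sub>0 M_pos by (simp_all add: R_def)
  have f_R: "L-lipschitz_on (cball 0 R) f"
    using f(1) R(2) by (auto intro: lipschitz_on_subset)
  hence cont_f: "continuous_on (cball 0 R) f"
    by (rule lipschitz_on_continuous_on)
  have "picard f x\<^sub>0 \<in> exp_bounded_curves R \<kappa> \<rightarrow> exp_bounded_curves R \<kappa>"
  proof (rule picard_maps_exp_bounded_curves[OF cont_f])
    have "M * \<epsilon> / (\<kappa> - \<omega>) \<le> 1 / 2"
      using gap \<open>\<omega> < \<kappa>\<close> by (simp add: field_simps)
    from mult_right_mono[OF this R(1)] show "M * norm x\<^sub>0 + M * \<epsilon> / (\<kappa> - \<omega>) * R \<le> R"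
      by (simp add: R_def)
  qed (use assms R in auto)
  then obtain x where x: "x \<in> exp_bounded_curves R \<kappa>" "\<And>t. t \<ge> 0 \<Longrightarrow> picard f x\<^sub>0 x t = x t"
    using picard_fixed_point_exists[OF f_R R(1) \<open>\<omega> < \<kappa>\<close> \<open>\<kappa> \<le> 0\<close>] by blast
  hence cont_x: "continuous_on {0..} x"
    by (simp add: exp_bounded_curves_def)
  moreover have "continuous_on {0..} (\<lambda>s. f (x s))"
    using norm_exp_bounded_curve_le[OF x(1) \<open>\<kappa> \<le> 0\<close> R(1)]
    by (intro continuous_on_compose2[OF cont_f cont_x]) auto
  ultimately have "mild_solution T f x\<^sub>0 x"
    using x(2) by (rule mild_solution_if_picard_fixed_point)
  moreover have "norm (x t) \<le> 2 * M * norm x\<^sub>0 * exp (\<kappa> * t)" if "t \<ge> 0" for t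
    using x(1) that by (simp add: exp_bounded_curves_def R_def)
  ultimately show thesis by (rule that)
qed

theorem locally_exponentially_stable_if_derivative_zero:
  assumes "\<omega> < 0" and f: "locally_lipschitz f" "f 0 = 0" "(f has_derivative (\<lambda>_. 0)) (at 0)"
  shows "locally_exponentially_stable T f"
proof -
  define \<epsilon> where "\<epsilon> = - \<omega> / (4 * M)"
  have \<epsilon>: "\<epsilon> > 0" "2 * M * \<epsilon> = \<omega> / 2 - \<omega>"
    using M_pos \<open>\<omega> < 0\<close> by (simp_all add: \<epsilon>_def field_simps)
  obtain u L where u: "u > 0" "L-lipschitz_on (cball 0 u) f"
    using f(1) unfolding locally_lipschitz_def by blast
  obtain v where v: "v > 0" "\<And>z. norm z < v \<Longrightarrow> norm (f z) \<le> \<epsilon> * norm z"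
    using has_derivative_zero_imp_norm_le[OF f(3,2) \<epsilon>(1)] by blast
  define d where "d = min u (v / 2)"
  have d: "d > 0" "L-lipschitz_on (cball 0 d) f" "\<And>z. norm z \<le> d \<Longrightarrow> norm (f z) \<le> \<epsilon> * norm z"
    using u v by (auto simp: d_def intro: lipschitz_on_subset)
  have "\<exists>x. mild_solution T f x\<^sub>0 x \<and>
      (\<forall>y. mild_solution T f x\<^sub>0 y \<longrightarrow> (\<forall>t\<ge>0. y t = x t)) \<and>
      (\<forall>t\<ge>0. norm (x t) \<le> 2 * M * exp (- (- \<omega> / 2) * t) * norm x\<^sub>0)"
    if "norm x\<^sub>0 < d / (2 * M)" for x\<^sub>0
  proof -
    have "2 * M * norm x\<^sub>0 \<le> d"
      using that M_pos by (simp add: field_simps)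
    with \<epsilon> \<open>\<omega> < 0\<close> obtain x where "mild_solution T f x\<^sub>0 x"
      "\<And>t. t \<ge> 0 \<Longrightarrow> norm (x t) \<le> 2 * M * norm x\<^sub>0 * exp (\<omega> / 2 * t)"
      using exp_decaying_mild_solution_exists[OF d(2,3), of "\<omega> / 2" x\<^sub>0] by auto
    thus ?thesis
      using mild_solution_unique[OF f(1)] by (intro exI[of _ x]) (auto simp: mult_ac)
  qed
  moreover have "d / (2 * M) > 0" "2 * M > 0" "- \<omega> / 2 > 0"
    using d(1) M_pos \<open>\<omega> < 0\<close> by auto
  ultimately show ?thesis
    unfolding locally_exponentially_stable_def by blast
qed

end

theorem theorem2p1:
  fixes smul :: "'k::real_or_complex \<Rightarrow> 'x::banach \<Rightarrow> 'x"
    and ip :: "'x \<Rightarrow> 'x \<Rightarrow> 'k"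
    and T :: "real \<Rightarrow> 'x \<Rightarrow>\<^sub>L 'x"
    and D :: "'x set"
    and A :: "'x \<Rightarrow> 'x"
    and f :: "'x \<Rightarrow> 'x"
  assumes "hilbert_space smul ip"
    and "c0_semigroup smul T"
    and "infinitesimal_generator T D A"
    and "locally_lipschitz f"
    and "f 0 = 0"
    and "(f has_derivative (\<lambda>_. 0)) (at 0)"
    and "exponentially_stable_semigroup T"
    and "\<exists>(\<omega>::real) (Q :: 'x \<Rightarrow>\<^sub>L 'x).
           Vector_Spaces.linear smul smul (blinfun_apply Q) \<and>
           boundedly_invertible Q \<and> self_adjoint_wrt ip Q \<and>
           (\<forall>x\<in>D. ip x (Q (A x)) + ip (A x) (Q x) \<le> of_real (\<omega> * (norm x)\<^sup>2))"
  shows "locally_exponentially_stable T f"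
proof -
  obtain M \<omega>\<^sub>0 where M: "\<omega>\<^sub>0 > 0" "\<And>t. t \<ge> 0 \<Longrightarrow> norm (T t) \<le> M * exp (- \<omega>\<^sub>0 * t)"
    using assms(7) unfolding exponentially_stable_semigroup_def by blast
  interpret exponentially_bounded_semigroup T "max 1 M" "- \<omega>\<^sub>0"
  proof
    show "norm (T t) \<le> max 1 M * exp (- \<omega>\<^sub>0 * t)" if "t \<ge> 0" for t
      by (rule order_trans[OF M(2)[OF that] mult_right_mono]) auto
  qed (use assms(2) in \<open>auto simp: c0_semigroup_def\<close>)
  show ?thesis
    using M(1) assms(4-6) by (intro locally_exponentially_stable_if_derivative_zero) auto
qed

end
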